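(* There is a function $g:(0,1)\to[0,\infty)$ with $g(p)\to 0$ as $p\to 0$ such that the following holds. For every $n\in\mathbb{N}$, every $p\in(0,1)$, every sequence $(a_1,\dots,a_n)\in\mathbb{R}^n$ and every real $x\neq 0$, if $\boldsymbol{\xi}=(\xi_1,\dots,\xi_n)$ has independent $\mathrm{Ber}(p)$ entries and $X:=a_1\xi_1+\dots+a_n\xi_n$, then \[ \Pr(X=x)\le \frac1e+g(p). \]
   Context: $\mathrm{Ber}(p)$ denotes the distribution of a random variable equal to $1$ with probability $p$ and $0$ with probability $1-p$. *)

theory Defs
  imports "HOL-Probability.Probability"
begin

definition Ber :: "real \<Rightarrow> real pmf" where
  "Ber p = map_pmf of_bool (bernoulli_pmf p)"

definition Ber_vec :: "nat \<Rightarrow> real \<Rightarrow> (nat \<Rightarrow> real) pmf" where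
  "Ber_vec n p = Pi_pmf {1..n} 0 (\<lambda>_. Ber p)"

lemma Ber_iff:
  assumes "0 < p" "p < 1"
  shows "\<mu> = Ber p \<longleftrightarrow> pmf \<mu> 1 = p \<and> pmf \<mu> 0 = 1 - p"
proof -
  have inj: "inj (of_bool :: bool \<Rightarrow> real)"
    by (simp add: inj_on_def)
  have one: "pmf (Ber p) 1 = p"
    using pmf_map_inj'[OF inj, of "bernoulli_pmf p" True] assms by (simp add: Ber_def)
  have zero: "pmf (Ber p) 0 = 1 - p"
    using pmf_map_inj'[OF inj, of "bernoulli_pmf p" False] assms by (simp add: Ber_def)
  have "\<mu> = Ber p" if \<mu>: "pmf \<mu> 1 = p" "pmf \<mu> 0 = 1 - p"
  proof (rule pmf_eqI)
    have supp: "pmf \<nu> y = 0"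
      if \<nu>: "pmf \<nu> 1 = p" "pmf \<nu> 0 = 1 - p" and y: "y \<noteq> 0" "y \<noteq> 1"
      for \<nu> :: "real pmf" and y
    proof -
      have "sum (pmf \<nu>) {0, 1, y} = measure_pmf.prob \<nu> {0, 1, y}"
        by (simp add: measure_measure_pmf_finite)
      also have "\<dots> \<le> 1" by simp
      finally have "pmf \<nu> y \<le> 0" using \<nu> y by (auto simp: sum.insert)
      then show ?thesis using pmf_nonneg[of \<nu> y] by linarith
    qed
    show "pmf \<mu> y = pmf (Ber p) y" for y
      using supp[OF \<mu>, of y] supp[OF one zero, of y] \<mu> one zero
      by (cases "y = 0"; cases "y = 1") auto
  qed
  with one zero show ?thesis by blast
qed

text \<open>
  The law \<open>Ber_vec n p\<close> represents every vector of independent \<open>Ber p\<close> variables, on whatever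
  probability space it lives: the distribution of \<open>a\<^sub>1 \<xi>\<^sub>1 + \<dots> + a\<^sub>n \<xi>\<^sub>n\<close> is always the one
  computed from \<open>Ber_vec n p\<close>. Working with the law avoids quantifying over the type of the
  sample space inside a formula.
\<close>

lemma (in prob_space) prob_sum_eq_Ber_vec:
  fixes \<xi> :: "nat \<Rightarrow> 'a \<Rightarrow> real" and a :: "nat \<Rightarrow> real"
  assumes indep: "indep_vars (\<lambda>_. borel) \<xi> {1..n}"
    and law: "\<And>i. i \<in> {1..n} \<Longrightarrow> distr M borel (\<xi> i) = distr (measure_pmf (Ber p)) borel (\<lambda>y. y)"
  shows "prob {\<omega> \<in> space M. (\<Sum>i=1..n. a i * \<xi> i \<omega>) = x} =
         measure_pmf.prob (Ber_vec n p) {v. (\<Sum>i=1..n. a i * v i) = x}"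
proof (cases "n = 0")
  case True
  then show ?thesis using prob_space by (cases "x = 0") auto
next
  case False
  then have ne: "{1..n} \<noteq> {}" by auto
  let ?N = "measure_pmf (Ber_vec n p)"
  let ?P = "\<Pi>\<^sub>M i\<in>{1..n}. (borel :: real measure)"
  let ?S = "{v \<in> space ?P. (\<Sum>i=1..n. a i * v i) = x}"
  have rv: "\<xi> i \<in> borel_measurable M" if "i \<in> {1..n}" for i
    using indep that by (auto simp: indep_vars_def)
  have X: "(\<lambda>\<omega>. \<lambda>i\<in>{1..n}. \<xi> i \<omega>) \<in> measurable M ?P"
    by (intro measurable_restrict rv)
  have Y: "(\<lambda>v. \<lambda>i\<in>{1..n}. v i) \<in> measurable ?N ?P"
    by (auto simp: space_PiM PiE_def)
  have "prob_space.indep_vars ?N (\<lambda>_. count_space UNIV) (\<lambda>i v. v i) {1..n}"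
    unfolding Ber_vec_def by (rule indep_vars_Pi_pmf) simp
  then have "prob_space.indep_vars ?N (\<lambda>_. borel) (\<lambda>i v. v i) {1..n}"
    by (rule prob_space.indep_vars_compose2[OF measure_pmf.prob_space_axioms, where Y = "\<lambda>_ y. y"])
       simp
  then have 1: "distr ?N ?P (\<lambda>v. \<lambda>i\<in>{1..n}. v i) = (\<Pi>\<^sub>M i\<in>{1..n}. distr ?N borel (\<lambda>v. v i))"
    by (subst (asm) prob_space.indep_vars_iff_distr_eq_PiM'[OF measure_pmf.prob_space_axioms ne])
       auto
  have 2: "distr M ?P (\<lambda>\<omega>. \<lambda>i\<in>{1..n}. \<xi> i \<omega>) = (\<Pi>\<^sub>M i\<in>{1..n}. distr M borel (\<xi> i))"
    using indep_vars_iff_distr_eq_PiM'[OF ne, of \<xi> "\<lambda>_. borel"] rv indep by blast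
  have "distr ?N borel (\<lambda>v. v i) = distr M borel (\<xi> i)" if i: "i \<in> {1..n}" for i
  proof -
    have "Ber p = map_pmf (\<lambda>v. v i) (Ber_vec n p)"
      using i by (simp add: Ber_vec_def Pi_pmf_component)
    then have "distr (measure_pmf (Ber p)) borel (\<lambda>y. y) =
        distr (distr ?N (count_space UNIV) (\<lambda>v. v i)) borel (\<lambda>y. y)"
      by (simp add: map_pmf_rep_eq)
    also have "\<dots> = distr ?N borel (\<lambda>v. v i)"
      by (subst distr_distr) (auto simp: o_def)
    finally show ?thesis using law[OF i] by simp
  qed
  then have "(\<Pi>\<^sub>M i\<in>{1..n}. distr ?N borel (\<lambda>v. v i)) = (\<Pi>\<^sub>M i\<in>{1..n}. distr M borel (\<xi> i))"
    by (intro PiM_cong) auto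
  with 1 2 have eq: "distr M ?P (\<lambda>\<omega>. \<lambda>i\<in>{1..n}. \<xi> i \<omega>) = distr ?N ?P (\<lambda>v. \<lambda>i\<in>{1..n}. v i)"
    by simp
  have S: "?S \<in> sets ?P" by measurable
  have "prob {\<omega> \<in> space M. (\<Sum>i=1..n. a i * \<xi> i \<omega>) = x} =
      measure (distr M ?P (\<lambda>\<omega>. \<lambda>i\<in>{1..n}. \<xi> i \<omega>)) ?S"
    by (subst measure_distr[OF X S])
       (auto intro!: arg_cong[where f = "measure M"] simp: space_PiM)
  also have "\<dots> = measure ?N {v. (\<Sum>i=1..n. a i * v i) = x}"
    unfolding eq by (subst measure_distr[OF Y S])
       (auto intro!: arg_cong[where f = "measure ?N"] simp: space_PiM)
  finally show ?thesis .
qed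

end

theory Submission
  imports Defs
begin

text \<open>
  Write \<open>m\<close> for the number of summands. If some coefficient \<open>a\<^sub>i\<close> differs from the target
  \<open>x\<close>, condition on \<open>\<xi>\<^sub>i\<close>: both remaining targets \<open>x\<close> and \<open>x - a\<^sub>i\<close> are nonzero, so the
  point probability is a convex combination of point probabilities at nonzero targets for
  \<open>m - 1\<close> summands. Induction thus reduces everything to the case where all coefficients equal
  \<open>x\<close>, in which the probability is exactly \<open>m p (1 - p)\<^sup>m\<^sup>-\<^sup>1 \<le> exp (p - 1)\<close>.
\<close>

text \<open>The index set is an arbitrary set rather than \<open>{1..n}\<close>, so that an
  induction may delete any chosen index.\<close>

definition lin_prob :: "real \<Rightarrow> ('a \<Rightarrow> real) \<Rightarrow> 'a set \<Rightarrow> real \<Rightarrow> real" where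
  "lin_prob p a A x = measure_pmf.prob (Pi_pmf A 0 (\<lambda>_. Ber p)) {\<xi>. (\<Sum>i\<in>A. a i * \<xi> i) = x}"

lemma lin_prob_empty: "lin_prob p a {} x = of_bool (x = 0)"
  by (simp add: lin_prob_def indicator_def)

lemma lin_prob_insert:
  assumes A: "finite A" "j \<notin> A" and p: "p \<in> {0<..<1}"
  shows "lin_prob p a (insert j A) x = p * lin_prob p a A (x - a j) + (1 - p) * lin_prob p a A x"
proof -
  let ?P = "Pi_pmf A 0 (\<lambda>_. Ber p)"
  let ?E = "{\<xi>. (\<Sum>i\<in>insert j A. a i * \<xi> i) = x}"
  have "Ber p \<bind> F = bernoulli_pmf p \<bind> (\<lambda>b. F (of_bool b))" for F :: "real \<Rightarrow> ('a \<Rightarrow> real) pmf"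
    by (simp add: Ber_def bind_map_pmf)
  then have "Pi_pmf (insert j A) 0 (\<lambda>_. Ber p) =
      bernoulli_pmf p \<bind> (\<lambda>b. map_pmf (\<lambda>f. f(j := of_bool b)) ?P)"
    using A by (simp add: Pi_pmf_insert' map_pmf_def)
  then have "lin_prob p a (insert j A) x =
      measure_pmf.expectation (bernoulli_pmf p)
        (\<lambda>b. measure_pmf.prob (map_pmf (\<lambda>f. f(j := of_bool b)) ?P) ?E)"
    by (simp add: lin_prob_def measure_pmf_bind
        measure_pmf.measure_bind[where N = "count_space UNIV"] measure_pmf_in_subprob_algebra)
  also have "\<dots> = measure_pmf.expectation (bernoulli_pmf p)
        (\<lambda>b. lin_prob p a A (if b then x - a j else x))"
  proof (rule arg_cong[where f = "measure_pmf.expectation (bernoulli_pmf p)"], rule ext)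
    \<comment> \<open>Coordinate \<open>j\<close> does not occur in the sum over \<open>A\<close>,
      so overwriting it only shifts the target by \<open>a j\<close> or by 0.\<close>
    fix b
    have "(\<Sum>i\<in>A. a i * (f(j := c)) i) = (\<Sum>i\<in>A. a i * f i)" for f c
      using A by (intro sum.cong) auto
    then show "measure_pmf.prob (map_pmf (\<lambda>f. f(j := of_bool b)) ?P) ?E =
        lin_prob p a A (if b then x - a j else x)"
      using A by (auto simp: lin_prob_def vimage_def algebra_simps
          intro!: arg_cong[where f = "measure_pmf.prob ?P"])
  qed
  also have "\<dots> = p * lin_prob p a A (x - a j) + (1 - p) * lin_prob p a A x"
    using p by simp
  finally show ?thesis .
qed

context
  fixes p c :: real and a :: "'a \<Rightarrow> real"
  assumes p: "p \<in> {0<..<1}" and c: "c \<noteq> 0"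
begin

text \<open>Every attainable sum is a nonnegative multiple of \<open>c\<close>. Conditioning can
  push the target one further step down, hence the induction over all \<open>k\<close>.\<close>

lemma lin_prob_const_neg:
  assumes "finite A" "\<And>i. i \<in> A \<Longrightarrow> a i = c"
  shows "lin_prob p a A (- (real (Suc k) * c)) = 0"
  using assms
proof (induction A arbitrary: k rule: finite_induct)
  case empty
  then show ?case using c by (simp add: lin_prob_empty del: of_nat_Suc)
next
  case (insert j A)
  have "- (real (Suc k) * c) - c = - (real (Suc (Suc k)) * c)"
    by (simp add: algebra_simps)
  then show ?case
    using insert.IH[of k] insert.IH[of "Suc k"] insert.hyps insert.prems p
    by (simp add: lin_prob_insert del: of_nat_Suc)
qed

lemma lin_prob_const_0:
  assumes "finite A" "\<And>i. i \<in> A \<Longrightarrow> a i = c"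
  shows "lin_prob p a A 0 = (1 - p) ^ card A"
  using assms
proof (induction A rule: finite_induct)
  case empty
  then show ?case by (simp add: lin_prob_empty)
next
  case (insert j A)
  then show ?case
    using lin_prob_const_neg[of A 0] p by (simp add: lin_prob_insert)
qed

text \<open>The sum hits \<open>c\<close> iff exactly one variable is 1. In the induction, a new
  variable equal to 1 forces all others to vanish.\<close>

lemma lin_prob_const_self:
  assumes "finite A" "\<And>i. i \<in> A \<Longrightarrow> a i = c"
  shows "lin_prob p a A c = real (card A) * p * (1 - p) ^ (card A - 1)"
  using assms
proof (induction A rule: finite_induct)
  case empty
  then show ?case using c by (simp add: lin_prob_empty)
next
  case (insert j A)
  then have "lin_prob p a (insert j A) c =
      p * (1 - p) ^ card A + (1 - p) * (real (card A) * p * (1 - p) ^ (card A - 1))"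
    using p by (simp add: lin_prob_insert lin_prob_const_0)
  \<comment> \<open>For \<open>card A = 0\<close> the truncated exponent \<open>card A - 1\<close>
    is harmless, since the factor \<open>real (card A)\<close> is 0.\<close>
  then show ?case
    using insert.hyps by (cases "card A") (simp_all add: algebra_simps)
qed

end

text \<open>Apply 1 + t \<le> exp t with t = mp - 1 and t = -p; the exponents add up to (mp - 1) -
  (m - 1)p = p - 1.\<close>

lemma binomial_one_le_exp:
  fixes p :: real
  assumes "p \<in> {0<..<1}"
  shows "real m * p * (1 - p) ^ (m - 1) \<le> exp (p - 1)"
proof (cases m)
  case (Suc k)
  have "real m * p \<le> exp (real m * p - 1)"
    using exp_ge_add_one_self[of "real m * p - 1"] by simp
  moreover have "(1 - p) ^ k \<le> exp (- p) ^ k"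
    using exp_ge_add_one_self[of "- p"] assms by (intro power_mono) auto
  ultimately have "real m * p * (1 - p) ^ k \<le> exp (real m * p - 1) * exp (- p) ^ k"
    using assms by (intro mult_mono) auto
  also have "\<dots> = exp (p - 1)"
    by (simp add: Suc exp_of_nat_mult[symmetric] exp_add[symmetric] algebra_simps)
  finally show ?thesis by (simp add: Suc)
qed simp

lemma lin_prob_le:
  assumes "finite A" "p \<in> {0<..<1}" "x \<noteq> 0"
  shows "lin_prob p a A x \<le> exp (p - 1)"
  using assms
\<comment> \<open>Removal induction allows \<open>j\<close> to be picked depending on
  \<open>A\<close> and \<open>x\<close>; \<open>x\<close> stays arbitrary because conditioning
  shifts the target.\<close>
proof (induction A arbitrary: x rule: finite_remove_induct)
  case empty
  then show ?case by (simp add: lin_prob_empty)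
next
  case (remove A)
  show ?case
  proof (cases "\<forall>i\<in>A. a i = x")
    case True
    then show ?thesis
      using lin_prob_const_self[of p x A a] binomial_one_le_exp[of p "card A"] remove by simp
  next
    case False
    then obtain j where j: "j \<in> A" "a j \<noteq> x" by blast
    have "lin_prob p a A x =
        p * lin_prob p a (A - {j}) (x - a j) + (1 - p) * lin_prob p a (A - {j}) x"
      using lin_prob_insert[of "A - {j}" j p a x] remove.hyps remove.prems j
      by (simp add: insert_absorb)
    also have "\<dots> \<le> exp (p - 1)"
      using remove.IH[OF j(1)] remove.prems j by (intro convex_bound_le) auto
    finally show ?thesis .
  qed
qed

theorem theorem1p8:
  shows "\<exists>g :: real \<Rightarrow> real.
    (\<forall>p\<in>{0<..<1}. 0 \<le> g p) \<and>
    (g \<longlongrightarrow> 0) (at 0 within {0<..<1}) \<and>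
    (\<forall>(n::nat) (p::real) (a::nat \<Rightarrow> real) (x::real).
       p \<in> {0<..<1} \<longrightarrow> x \<noteq> 0 \<longrightarrow>
       measure_pmf.prob (Ber_vec n p) {\<xi>. (\<Sum>i=1..n. a i * \<xi> i) = x} \<le> 1 / exp 1 + g p)"
\<comment> \<open>The witness is the gap between the uniform bound \<open>exp (p - 1)\<close> and
  its limit 1/e as p tends to 0.\<close>
proof (intro exI[of _ "\<lambda>p. exp (p - 1) - 1 / exp 1"] conjI ballI allI impI)
  fix p :: real
  assume "p \<in> {0<..<1}"
  then show "0 \<le> exp (p - 1) - 1 / exp 1"
    by (simp add: exp_diff divide_right_mono)
next
  have "((\<lambda>p::real. exp (p - 1) - 1 / exp 1) \<longlongrightarrow> exp (0 - 1) - 1 / exp 1) (at 0 within {0<..<1})"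
    by (intro tendsto_intros)
  then show "((\<lambda>p::real. exp (p - 1) - 1 / exp 1) \<longlongrightarrow> 0) (at 0 within {0<..<1})"
    by (simp add: exp_minus field_simps)
next
  fix n :: nat and p :: real and a :: "nat \<Rightarrow> real" and x :: real
  assume "p \<in> {0<..<1}" "x \<noteq> 0"
  then show "measure_pmf.prob (Ber_vec n p) {\<xi>. (\<Sum>i=1..n. a i * \<xi> i) = x}
      \<le> 1 / exp 1 + (exp (p - 1) - 1 / exp 1)"
    using lin_prob_le[of "{1..n}" p x a] by (simp add: lin_prob_def Ber_vec_def)
qed

end
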